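(* Let $n\ge 1$ be an integer and let \[H^{*}_{n}(z)=(z+i)(z-i)(z+2i)(z-2i)\cdots(z+ni)(z-ni)=(z^2+1)(z^2+2^2)\cdots(z^2+n^2).\] Define, for complex $s$, \[\zeta^{H^{*}}_{n}(s)=\sum_{k=1}^{n}(-1)^{k-1}\binom{2n}{n+k}k^{-s},\] and, for $0<\operatorname{Re} s<2n$, \[L_n(s)=\int_0^{+\infty}\frac{x^{s-1}}{H^{*}_{n}(x)}\,dx .\] Then: (i) $\zeta^{H^{*}}_{n}$ is an entire function, and its "trivial zeros" include the negative even integers in the range $-2n+2\le s\le -2$, i.e. $\zeta^{H^{*}}_{n}(-2m)=0$ for $1\le m\le n-1$; (ii) for $0<\operatorname{Re} s<2n$, \[L_n(s)=\frac{\pi}{\sin\!\left(\frac{s\pi}{2}\right)}\,\zeta^{H^{*}}_{n}(-s)\,\frac{1}{(2n)!};\] (iii) by this formula $L_n$ extends meromorphically to the whole $s$-plane, with possible poles only at the even integers, and with no poles at the points $s=2m$, $1\le m\le n-1$. In particular, for $n=1$ and $s=1$ this gives $\int_0^{+\infty}\frac{dx}{x^2+1}=\frac{\pi}{2}$.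
   Context: $s$ denotes a complex variable $s=\sigma+it$; an inequality such as $0<s<2n$ in the paper means $0<\operatorname{Re}s<2n$. The power $x^{s-1}$ for $x>0$ is $e^{(s-1)\log x}$ with real logarithm, and $k^{-s}=e^{-s\log k}$. *)

theory Defs
  imports "HOL-Complex_Analysis.Complex_Analysis"
begin

definition Hstar :: "nat \<Rightarrow> complex \<Rightarrow> complex" where
  "Hstar n z = (\<Prod>k=1..n. (z + of_nat k * \<i>) * (z - of_nat k * \<i>))"

lemma Hstar_altdef: "Hstar n z = (\<Prod>k=1..n. z\<^sup>2 + (of_nat k)\<^sup>2)"
  unfolding Hstar_def by (intro prod.cong refl) (simp add: algebra_simps power2_eq_square)

definition zetaHstar :: "nat \<Rightarrow> complex \<Rightarrow> complex" where
  "zetaHstar n s =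
     (\<Sum>k=1..n. (-1) ^ (k - 1) * of_nat ((2 * n) choose (n + k)) * of_nat k powr (- s))"

definition L_integrand :: "nat \<Rightarrow> complex \<Rightarrow> real \<Rightarrow> complex" where
  "L_integrand n s x = of_real x powr (s - 1) / Hstar n (of_real x)"

text \<open>Only meaningful for \<open>0 < Re s < 2 * n\<close>.\<close>

definition L :: "nat \<Rightarrow> complex \<Rightarrow> complex" where
  "L n s = (LBINT x=0..\<infinity>. L_integrand n s x)"

definition even_integers :: "complex set" where
  "even_integers = range (\<lambda>k::int. of_int (2 * k))"

text \<open>At an even integer the sine vanishes and this is \<open>0\<close> by the convention
  \<open>x / 0 = 0\<close>; its value there has no mathematical meaning.\<close>

definition L_formula :: "nat \<Rightarrow> complex \<Rightarrow> complex" where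
  "L_formula n s =
     of_real pi / sin (s * of_real pi / 2) * zetaHstar n (- s) * (1 / fact (2 * n))"

end

(*
  Substituting t = x^2 / (x^2 + k^2) turns the integral of x^(s-1) / (x^2 + k^2) into half a Beta
  integral, so by Euler's reflection formula it equals k^(s-2) * pi / (2 sin(pi s / 2)) for
  0 < s < 2. The partial fraction expansion of 1 / H in x^2 then gives the formula for L on this
  real interval. Since L is holomorphic on the strip 0 < Re s < 2n (dominated convergence for the
  difference quotients), the identity
      sin(pi s / 2) * (2n)! * L(s) = pi * zeta(-s)
  extends to the whole strip. Evaluating it at s = 2m gives the trivial zeros, and continuity of
  L there shows that the singularities of the right-hand side of (ii) at these points are removable.
*)
theory Submission
  imports Defs "HOL-Real_Asymp.Real_Asymp"
begin

section \<open>Mellin transform of a single term \<open>1 / (x\<^sup>2 + k\<^sup>2)\<close>\<close>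

text \<open>Comparison with one power on (0,1] and another on [1,oo). It serves twice: for a single
  partial fraction and for the full integrand of \<open>L\<close>.\<close>

lemma set_integrable_powr_bounds:
  fixes f :: "real \<Rightarrow> 'b::{banach, second_countable_topology}"
  assumes f: "set_borel_measurable lborel {0<..} f"
    and "a > -1" and "b < -1"
    and f0: "\<And>x. 0 < x \<Longrightarrow> x \<le> 1 \<Longrightarrow> norm (f x) \<le> x powr a"
    and f1: "\<And>x. 1 \<le> x \<Longrightarrow> norm (f x) \<le> x powr b"
  shows "set_integrable lborel {0<..} f"
proof -
  \<comment> \<open>The known integrals of powers are gauge integrals. Nonnegativity makes them
    absolute, and \<open>integrable_completion\<close> passes from Lebesgue measure to
    \<open>lborel\<close>.\<close>
  have powr_integrable: "set_integrable lborel S (\<lambda>x. x powr c)"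
    if "(\<lambda>x. x powr c) integrable_on S" "S \<in> sets lborel" for S :: "real set" and c :: real
  proof -
    have "(\<lambda>x. x powr c) absolutely_integrable_on S"
      using that by (subst absolutely_integrable_on_iff_nonneg) auto
    thus ?thesis
      using that unfolding set_integrable_def
      by (subst (asm) integrable_completion) (auto intro!: borel_measurable_scaleR)
  qed
  have "(\<lambda>x. x powr a) integrable_on {0..1}"
    using has_integral_powr_from_0[of a 1] \<open>a > -1\<close> by (auto simp: integrable_on_def)
  hence "set_integrable lborel {0..1} (\<lambda>x. x powr a)"
    by (intro powr_integrable) auto
  hence "set_integrable lborel {0<..1} (\<lambda>x. x powr a)"
    by (rule set_integrable_subset) auto
  hence 0: "set_integrable lborel {0<..1} f"
    by (rule set_integrable_bound) (use f0 in \<open>auto intro: set_borel_measurable_subset[OF f]\<close>)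
  have "(\<lambda>x. x powr b) integrable_on {1..}"
    using has_integral_powr_to_inf[of b 1] \<open>b < -1\<close> by (auto simp: integrable_on_def)
  hence "set_integrable lborel {1..} (\<lambda>x. x powr b)"
    by (intro powr_integrable) auto
  hence 1: "set_integrable lborel {1..} f"
    by (rule set_integrable_bound) (use f1 in \<open>auto intro: set_borel_measurable_subset[OF f]\<close>)
  have "{0<..} = {0<..1} \<union> {1::real..}"
    by auto
  thus ?thesis
    using set_integrable_Un[OF 0 1] by simp
qed

lemma set_integrable_powr_div_sum_squares:
  fixes \<sigma> k :: real
  assumes "0 < \<sigma>" "\<sigma> < 2" "k \<ge> 1"
  shows "set_integrable lborel {0<..} (\<lambda>x. x powr (\<sigma> - 1) / (x\<^sup>2 + k\<^sup>2))"
proof (rule set_integrable_powr_bounds[where a = "\<sigma> - 1" and b = "\<sigma> - 3"])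
  have "1 \<le> k\<^sup>2"
    using assms by simp
  fix x :: real
  assume "0 < x" "x \<le> 1"
  have "x powr (\<sigma> - 1) / (x\<^sup>2 + k\<^sup>2) \<le> x powr (\<sigma> - 1) / 1"
    using \<open>1 \<le> k\<^sup>2\<close> zero_le_power2[of x]
    by (intro divide_left_mono mult_pos_pos) (linarith | simp)+
  thus "norm (x powr (\<sigma> - 1) / (x\<^sup>2 + k\<^sup>2)) \<le> x powr (\<sigma> - 1)"
    by simp
next
  fix x :: real
  assume "1 \<le> x"
  hence "x powr (\<sigma> - 1) / (x\<^sup>2 + k\<^sup>2) \<le> x powr (\<sigma> - 1) / x\<^sup>2"
    by (intro divide_left_mono mult_pos_pos add_pos_nonneg) auto
  also have "\<dots> = x powr (\<sigma> - 1) / x powr 2"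
    using \<open>1 \<le> x\<close> by simp
  also have "\<dots> = x powr (\<sigma> - 3)"
    by (simp flip: powr_diff)
  finally show "norm (x powr (\<sigma> - 1) / (x\<^sup>2 + k\<^sup>2)) \<le> x powr (\<sigma> - 3)"
    by simp
qed (use assms in \<open>auto simp: set_borel_measurable_def\<close>)

text \<open>Euler's reflection formula, transferred from the complex Gamma function. At integers
  \<open>a\<close> both sides are \<open>0\<close> by convention: one Gamma factor sits at a pole,
  and the sine vanishes.\<close>

lemma Beta_reflection_real:
  fixes a :: real
  shows "Beta a (1 - a) = pi / sin (pi * a)"
proof -
  have "complex_of_real (Beta a (1 - a)) = of_real (pi / sin (pi * a))"
    using Gamma_reflection_complex[of "of_real a"]
    by (simp add: Beta_def flip: Gamma_complex_of_real sin_of_real)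
  thus ?thesis
    by (simp only: of_real_eq_iff)
qed

lemma integral_powr_div_sum_squares:
  fixes \<sigma> k :: real
  assumes "0 < \<sigma>" "\<sigma> < 2" "k \<ge> 1"
  shows "(LINT x:{0<..}|lborel. x powr (\<sigma> - 1) / (x\<^sup>2 + k\<^sup>2))
         = k powr (\<sigma> - 2) * pi / (2 * sin (pi * \<sigma> / 2))"
proof -
  define a where "a = \<sigma> / 2"
  \<comment> \<open>The Beta integrand with parameters \<open>a\<close> and \<open>1 - a\<close>;
    for 0 < \<sigma> < 2 both are positive.\<close>
  define f where "f = (\<lambda>t::real. t powr (a - 1) * (1 - t) powr (- a))"
  define g where "g = (\<lambda>x. x\<^sup>2 / (x\<^sup>2 + k\<^sup>2))"
  define g' where "g' = (\<lambda>x. 2 * x * k\<^sup>2 / (x\<^sup>2 + k\<^sup>2)\<^sup>2)"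
  have pos: "x\<^sup>2 + k\<^sup>2 > 0" for x
    using assms by (intro add_nonneg_pos) auto
  have nz: "x\<^sup>2 + k\<^sup>2 \<noteq> 0" for x
    using pos[of x] by linarith
  have g: "0 < g x" "g x < 1" if "x > 0" for x
    using that pos[of x] assms by (auto simp: g_def)
  \<comment> \<open>The exponents \<open>a - 1\<close> and \<open>- a\<close> add up to
    \<open>-1\<close>, so \<open>f (g x)\<close> carries exactly one factor \<open>D\<close>. It
    cancels one of the two in the denominator of \<open>g' x\<close>.\<close>
  have fg: "f (g x) * g' x = 2 * k powr (2 - \<sigma>) * (x powr (\<sigma> - 1) / (x\<^sup>2 + k\<^sup>2))"
    if x: "x > 0" for x
  proof -
    define D where "D = x\<^sup>2 + k\<^sup>2"
    have D: "D > 0" using pos by (simp add: D_def)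
    have "D powr (a - 1) * D powr (- a) = D powr (- 1)"
      by (simp only: flip: powr_add) simp
    hence Dpowr: "D powr (a - 1) * D powr (- a) = 1 / D"
      using D by (simp add: powr_minus_divide)
    have "1 - g x = k\<^sup>2 / D"
      using nz[of x] by (simp add: g_def D_def field_simps)
    hence "f (g x) = (x\<^sup>2) powr (a - 1) * (k\<^sup>2) powr (- a) / (D powr (a - 1) * D powr (- a))"
      using D by (simp add: f_def g_def D_def[symmetric] powr_divide)
    also note Dpowr
    also have "(x\<^sup>2) powr (a - 1) = x powr (\<sigma> - 2)"
      using x by (simp add: powr_powr a_def right_diff_distrib flip: powr_numeral)
    also have "(k\<^sup>2) powr (- a) = k powr (- \<sigma>)"
      using assms by (simp add: powr_powr a_def flip: powr_numeral)
    finally have "f (g x) * g' x = (x powr (\<sigma> - 2) * x) * (k powr (-\<sigma>) * k\<^sup>2) * 2 / D"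
      using D by (simp add: g'_def D_def[symmetric] power2_eq_square[of D])
    also have "x powr (\<sigma> - 2) * x = x powr (\<sigma> - 2) * x powr 1"
      using x by simp
    also have "\<dots> = x powr (\<sigma> - 1)"
      by (simp only: flip: powr_add) simp
    also have "k powr (-\<sigma>) * k\<^sup>2 = k powr (-\<sigma>) * k powr 2"
      using assms by simp
    also have "\<dots> = k powr (2 - \<sigma>)"
      by (simp only: flip: powr_add) simp
    finally show ?thesis
      by (simp add: D_def)
  qed
  note integrable = set_integrable_powr_div_sum_squares[OF assms]
  have int_fg: "set_integrable lborel (einterval 0 \<infinity>) (\<lambda>x. f (g x) * g' x)"
    using set_integrable_mult_right[of "2 * k powr (2 - \<sigma>)", OF integrable]
    unfolding zero_ereal_def einterval_eq
    by (subst set_integrable_cong[OF refl refl]) (auto simp: fg)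
  have deriv: "(g has_real_derivative g' x) (at x)" for x
    unfolding g_def g'_def using nz[of x]
    by (auto intro!: derivative_eq_intros simp: field_simps power2_eq_square)
  have contf: "isCont f (g x)" if "x > 0" for x
    unfolding f_def using g[OF that] by (intro continuous_intros) auto
  have contg': "isCont g' x" for x
    unfolding g'_def using nz[of x] by (intro continuous_intros) auto
  have lim0: "((ereal \<circ> g \<circ> real_of_ereal) \<longlongrightarrow> 0) (at_right 0)"
  proof -
    have "isCont g 0"
      unfolding g_def using nz[of 0] by (intro continuous_intros) auto
    hence "(g \<longlongrightarrow> 0) (at_right 0)"
      by (auto simp: isCont_def g_def intro: tendsto_mono[OF at_le])
    thus ?thesis
      unfolding zero_ereal_def by (simp add: ereal_tendsto_simps comp_assoc)
  qed
  have lim1: "((ereal \<circ> g \<circ> real_of_ereal) \<longlongrightarrow> 1) (at_left \<infinity>)"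
  proof -
    have "(g \<longlongrightarrow> 1) at_top"
      unfolding g_def by real_asymp
    thus ?thesis
      unfolding one_ereal_def by (simp add: ereal_tendsto_simps comp_assoc)
  qed
  \<comment> \<open>Integrability is known on the \<open>x\<close> side only. As \<open>f\<close>
    and \<open>g'\<close> are nonnegative on the relevant ranges, the substitution rule yields
    integrability of \<open>f\<close> as well as equality of the integrals.\<close>
  note subst = interval_integral_substitution_nonneg[of 0 \<infinity> g g' f 0 1,
      OF _ deriv contf contg' _ _ lim0 lim1 int_fg]
  have f_int: "set_integrable lborel (einterval 0 1) f"
    by (rule subst(1)) (auto simp: f_def g'_def)
  have f_subst: "(LBINT x=0..1. f x) = (LBINT x=0..\<infinity>. f (g x) * g' x)"
    by (rule subst(2)) (auto simp: f_def g'_def)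
  have "(LBINT x=0..1. f x) = (LINT x:{0<..<1}|lborel. f x)"
    unfolding zero_ereal_def one_ereal_def
    by (simp add: interval_lebesgue_integral_def)
  also have "\<dots> = integral {0<..<1} f"
    using f_int unfolding zero_ereal_def one_ereal_def
    by (intro set_borel_integral_eq_integral) auto
  also have "\<dots> = Beta a (1 - a)"
  proof -
    have "(f has_integral Beta a (1 - a)) {0..1}"
      using has_integral_Beta_real[of a "1 - a"] assms by (simp add: f_def a_def)
    thus ?thesis
      by (subst (asm) has_integral_Icc_iff_Ioo) (rule integral_unique)
  qed
  also have "\<dots> = pi / sin (pi * \<sigma> / 2)"
    by (simp add: Beta_reflection_real a_def)
  finally have 1: "(LBINT x=0..1. f x) = pi / sin (pi * \<sigma> / 2)" .
  have "(LBINT x=0..\<infinity>. f (g x) * g' x) = (LINT x:{0<..}|lborel. f (g x) * g' x)"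
    unfolding zero_ereal_def by (rule interval_integral_to_infinity_eq)
  also have "\<dots> = (LINT x:{0<..}|lborel. 2 * k powr (2 - \<sigma>) * (x powr (\<sigma> - 1) / (x\<^sup>2 + k\<^sup>2)))"
    by (intro set_lebesgue_integral_cong) (auto simp: fg)
  also have "\<dots> = 2 * k powr (2 - \<sigma>) * (LINT x:{0<..}|lborel. x powr (\<sigma> - 1) / (x\<^sup>2 + k\<^sup>2))"
    by (rule set_integral_mult_right)
  finally have "2 * k powr (2 - \<sigma>) * (LINT x:{0<..}|lborel. x powr (\<sigma> - 1) / (x\<^sup>2 + k\<^sup>2))
      = pi / sin (pi * \<sigma> / 2)"
    using f_subst 1 by simp
  moreover have "k powr (\<sigma> - 2) * k powr (2 - \<sigma>) = 1"
    using assms by (simp flip: powr_add)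
  hence "(LINT x:{0<..}|lborel. x powr (\<sigma> - 1) / (x\<^sup>2 + k\<^sup>2))
      = k powr (\<sigma> - 2)
        * (2 * k powr (2 - \<sigma>) * (LINT x:{0<..}|lborel. x powr (\<sigma> - 1) / (x\<^sup>2 + k\<^sup>2))) / 2"
    by simp
  ultimately show ?thesis
    by simp
qed

section \<open>Partial fractions of \<open>1 / Hstar n x\<close> in the variable
  \<open>x\<^sup>2\<close>\<close>

text \<open>Induction on the set of factors: divide the expansion for \<open>A\<close> by the new
  factor \<open>y + a b\<close> and split each product of two linear denominators. The pieces over
  \<open>y + a b\<close> then have to be summed.\<close>

lemma inverse_prod_partial_fractions:
  fixes a :: "'i \<Rightarrow> 'a::field"
  assumes "finite A" "A \<noteq> {}" "inj_on a A" "\<And>i. i \<in> A \<Longrightarrow> y + a i \<noteq> 0"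
  shows "1 / (\<Prod>i\<in>A. y + a i) = (\<Sum>i\<in>A. 1 / (\<Prod>j\<in>A - {i}. a j - a i) / (y + a i))"
  using assms
proof (induction A arbitrary: y rule: finite_ne_induct)
  case (singleton b)
  then show ?case by simp
next
  case (insert b A)
  define P where "P = (\<lambda>i. \<Prod>j\<in>A - {i}. a j - a i)"
  have ne: "a i \<noteq> a b" if "i \<in> A" for i
    using insert.prems(1) insert.hyps that by (auto simp: inj_on_def)
  have inj: "inj_on a A"
    using insert.prems(1) by simp
  have P_insert: "(\<Prod>j\<in>insert b A - {i}. a j - a i) = (a b - a i) * P i" if "i \<in> A" for i
  proof -
    have "insert b A - {i} = insert b (A - {i})"
      using that insert.hyps by auto
    thus ?thesis
      using insert.hyps by (simp add: P_def)
  qed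
  \<comment> \<open>the induction hypothesis at \<open>y = - a b\<close> is the coefficient of the new term\<close>
  have at_b: "1 / (\<Prod>i\<in>A. a i - a b) = (\<Sum>i\<in>A. 1 / P i / (a i - a b))"
    using insert.IH[OF inj, of "- a b"] ne by (simp add: P_def)
  have at_y: "1 / (\<Prod>i\<in>A. y + a i) = (\<Sum>i\<in>A. 1 / P i / (y + a i))"
    using insert.IH[OF inj, of y] insert.prems by (simp add: P_def)
  have yb: "y + a b \<noteq> 0"
    using insert.prems by simp
  have "1 / (\<Prod>i\<in>insert b A. y + a i) = (\<Sum>i\<in>A. 1 / P i / (y + a i)) / (y + a b)"
    unfolding at_y[symmetric] using insert.hyps by (simp add: mult.commute)
  also have "\<dots> = (\<Sum>i\<in>A. 1 / ((a b - a i) * P i) / (y + a i) + 1 / P i / (a i - a b) / (y + a b))"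
    unfolding sum_divide_distrib
  proof (intro sum.cong refl)
    fix i assume i: "i \<in> A"
    \<comment> \<open>Two-term partial fractions. For \<open>p = 0\<close> both sides are
      \<open>0\<close> by the convention on division, so the identity can be applied to
      \<open>P i\<close> directly.\<close>
    have "1 / p / u / v = 1 / ((v - u) * p) / u + 1 / p / (u - v) / v"
      if "u \<noteq> 0" "v \<noteq> 0" "u \<noteq> v" for p u v :: 'a
    proof (cases "p = 0")
      case False
      have "u - v \<noteq> 0" using that by auto
      have "v - u = - (u - v)" by simp
      hence "1 / ((v - u) * p) = - (1 / p / (u - v))"
        by (simp only: mult_minus_left divide_minus_right divide_divide_eq_left mult.commute[of p])
      hence "1 / ((v - u) * p) / u + 1 / p / (u - v) / v = 1 / p / (u - v) * (1 / v - 1 / u)"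
        by (simp only: right_diff_distrib) simp
      also have "1 / v - 1 / u = (u - v) / (u * v)"
        using that by (simp add: field_simps)
      finally show ?thesis
        using \<open>u - v \<noteq> 0\<close> by simp
    qed auto
    from this[of "y + a i" "y + a b" "P i"]
    show "1 / P i / (y + a i) / (y + a b)
        = 1 / ((a b - a i) * P i) / (y + a i) + 1 / P i / (a i - a b) / (y + a b)"
      using ne[OF i] insert.prems i by simp
  qed
  also have "\<dots> = (\<Sum>i\<in>A. 1 / ((a b - a i) * P i) / (y + a i)) + 1 / (\<Prod>i\<in>A. a i - a b) / (y + a b)"
    unfolding sum.distrib at_b sum_divide_distrib ..
  also have "\<dots> = (\<Sum>i\<in>insert b A. 1 / (\<Prod>j\<in>insert b A - {i}. a j - a i) / (y + a i))"
  proof -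
    have "insert b A - {b} = A"
      using insert.hyps by auto
    thus ?thesis
      using insert.hyps by (simp add: P_insert add.commute)
  qed
  finally show ?case .
qed

text \<open>Split each factor as (j - k)(j + k). The differences contribute (-1)^(k-1) (k-1)!
  (n-k)!, the sums (n+k)! / (k! 2k), where 2k is the omitted factor at j = k. The formal proof is an
  induction on \<open>n\<close> starting at \<open>n = k\<close>.\<close>

lemma prod_diff_squares:
  fixes n k :: nat
  assumes "1 \<le> k" "k \<le> n"
  shows "(\<Prod>j\<in>{1..n} - {k}. (real j)\<^sup>2 - (real k)\<^sup>2)
       = (-1) ^ (k - 1) * fact (n - k) * fact (n + k) / (2 * (real k)\<^sup>2)"
  using assms(2)
proof (induction n rule: dec_induct)
  \<comment> \<open>At \<open>n = k\<close> only indices below \<open>k\<close> occur, so all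
    factors are negative and the whole sign arises here; the factors added in the induction step are
    positive.\<close>
  case base
  obtain m where k: "k = Suc m"
    using assms(1) by (cases k) auto
  have "(\<Prod>j=1..m. (real j)\<^sup>2 - (real k)\<^sup>2)
      = (\<Prod>j=1..m. (-1) * (real (Suc m - j) * (real k + real j)))"
    by (intro prod.cong refl) (auto simp: k of_nat_diff power2_eq_square algebra_simps)
  also have "\<dots> = (-1) ^ m * ((\<Prod>j=1..m. real (Suc m - j)) * (\<Prod>j=1..m. real k + real j))"
    by (simp only: prod.distrib prod_constant card_atLeastAtMost diff_Suc_1)
  also have "(\<Prod>j=1..m. real (Suc m - j)) = fact m"
    unfolding fact_prod of_nat_prod
    by (rule prod.reindex_bij_witness[of _ "\<lambda>j. Suc m - j" "\<lambda>j. Suc m - j"]) auto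
  also have "(\<Prod>j=1..m. real k + real j) = fact (k + m) / fact k"
    by (induction m) (simp_all add: algebra_simps add_divide_distrib)
  finally have "(\<Prod>j=1..m. (real j)\<^sup>2 - (real k)\<^sup>2) = (-1) ^ m * (fact m * (fact (k + m) / fact k))" .
  moreover have "{1..k} - {k} = {1..m}"
    using k by auto
  moreover have "fact (k + k) = 2 * real k * fact (k + m)" "fact k = real k * fact m"
    by (auto simp: k algebra_simps)
  moreover have "k - 1 = m" "real k \<noteq> 0"
    using k by auto
  ultimately show ?case
    by (simp add: power2_eq_square)
next
  case (step n)
  have "{1..Suc n} - {k} = insert (Suc n) ({1..n} - {k})"
    using step.hyps by auto
  hence "(\<Prod>j\<in>{1..Suc n} - {k}. (real j)\<^sup>2 - (real k)\<^sup>2)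
    = ((real (Suc n))\<^sup>2 - (real k)\<^sup>2) * (\<Prod>j\<in>{1..n} - {k}. (real j)\<^sup>2 - (real k)\<^sup>2)"
    by simp
  also have "(real (Suc n))\<^sup>2 - (real k)\<^sup>2 = real (Suc n - k) * real (Suc n + k)"
    using step.hyps by (simp add: of_nat_diff power2_eq_square algebra_simps)
  finally show ?case
    using step by (simp add: Suc_diff_le)
qed

text \<open>The coefficient 2 k^2 (-1)^(k-1) / ((n-k)! (n+k)!) is rewritten with a binomial over
  (2n)! so that the coefficients of \<open>zetaHstar\<close> become visible.\<close>

lemma inverse_prod_squares_partial_fractions:
  assumes "n \<ge> 1"
  shows "1 / (\<Prod>k=1..n. x\<^sup>2 + (real k)\<^sup>2)
       = (\<Sum>k=1..n. (-1) ^ (k - 1) * real ((2 * n) choose (n + k)) * 2 * (real k)\<^sup>2 / fact (2 * n)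
            * (1 / (x\<^sup>2 + (real k)\<^sup>2)))"
proof -
  have "x\<^sup>2 + (real k)\<^sup>2 \<noteq> 0" if "k \<ge> 1" for k
    using that by (auto simp: sum_power2_eq_zero_iff)
  moreover have "inj_on (\<lambda>k. (real k)\<^sup>2) {1..n}"
    by (auto simp: inj_on_def)
  ultimately have "1 / (\<Prod>k=1..n. x\<^sup>2 + (real k)\<^sup>2)
    = (\<Sum>k=1..n. 1 / (\<Prod>j\<in>{1..n} - {k}. (real j)\<^sup>2 - (real k)\<^sup>2) / (x\<^sup>2 + (real k)\<^sup>2))"
    using assms by (intro inverse_prod_partial_fractions) auto
  also have "\<dots> = (\<Sum>k=1..n. (-1) ^ (k - 1) * real ((2 * n) choose (n + k)) * 2 * (real k)\<^sup>2 / fact (2 * n)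
            * (1 / (x\<^sup>2 + (real k)\<^sup>2)))"
  proof (intro sum.cong refl)
    fix k assume k: "k \<in> {1..n}"
    have "1 / (\<Prod>j\<in>{1..n} - {k}. (real j)\<^sup>2 - (real k)\<^sup>2)
      = (-1) ^ (k - 1) * real ((2 * n) choose (n + k)) * 2 * (real k)\<^sup>2 / fact (2 * n)"
    proof -
      have "2 * n - (n + k) = n - k" by simp
      hence "real ((2 * n) choose (n + k)) / fact (2 * n) = 1 / (fact (n - k) * fact (n + k))"
        using k by (subst binomial_fact) auto
      moreover have "1 / (-1 :: real) ^ (k - 1) = (-1) ^ (k - 1)"
        by (cases "even (k - 1)") auto
      moreover have "1 / (\<Prod>j\<in>{1..n} - {k}. (real j)\<^sup>2 - (real k)\<^sup>2)
        = 1 / (-1) ^ (k - 1) * (1 / (fact (n - k) * fact (n + k))) * (2 * (real k)\<^sup>2)"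
        using k by (subst prod_diff_squares) simp_all
      ultimately have "1 / (\<Prod>j\<in>{1..n} - {k}. (real j)\<^sup>2 - (real k)\<^sup>2)
        = (-1) ^ (k - 1) * (real ((2 * n) choose (n + k)) / fact (2 * n)) * (2 * (real k)\<^sup>2)"
        by (simp only:)
      thus ?thesis
        by simp
    qed
    thus "1 / (\<Prod>j\<in>{1..n} - {k}. (real j)\<^sup>2 - (real k)\<^sup>2) / (x\<^sup>2 + (real k)\<^sup>2)
      = (-1) ^ (k - 1) * real ((2 * n) choose (n + k)) * 2 * (real k)\<^sup>2 / fact (2 * n)
            * (1 / (x\<^sup>2 + (real k)\<^sup>2))"
      by simp
  qed
  finally show ?thesis .
qed

section \<open>Convergence of the integral on the strip 0 < Re s < 2n\<close>

lemma Hstar_of_real: "Hstar n (of_real x) = of_real (\<Prod>k=1..n. x\<^sup>2 + (real k)\<^sup>2)"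
  by (simp add: Hstar_altdef)

text \<open>The first bound controls the integrand near 0, the second near infinity.\<close>

lemma prod_sum_squares_ge:
  fixes x :: real
  shows "1 \<le> (\<Prod>k=1..n. x\<^sup>2 + (real k)\<^sup>2)" "x ^ (2 * n) \<le> (\<Prod>k=1..n. x\<^sup>2 + (real k)\<^sup>2)"
proof -
  show "1 \<le> (\<Prod>k=1..n. x\<^sup>2 + (real k)\<^sup>2)"
    by (intro prod_ge_1) (auto intro!: add_increasing)
  have "(\<Prod>k=1..n. x\<^sup>2) \<le> (\<Prod>k=1..n. x\<^sup>2 + (real k)\<^sup>2)"
    by (intro prod_mono) auto
  thus "x ^ (2 * n) \<le> (\<Prod>k=1..n. x\<^sup>2 + (real k)\<^sup>2)"
    by (simp add: power_mult)
qed

lemma norm_L_integrand: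
  assumes "x > 0"
  shows "norm (L_integrand n s x) = x powr (Re s - 1) / (\<Prod>k=1..n. x\<^sup>2 + (real k)\<^sup>2)"
  using assms prod_sum_squares_ge(1)[where n = n and x = x]
  unfolding L_integrand_def Hstar_of_real norm_divide norm_of_real
  by (simp add: norm_powr_real_powr)

lemma L_integrand_measurable: "set_borel_measurable lborel {0<..} (L_integrand n s)"
proof -
  have "(\<Prod>k=1..n. x\<^sup>2 + (real k)\<^sup>2) \<noteq> 0" for x :: real
    using prod_sum_squares_ge(1)[where n = n and x = x] by linarith
  moreover have "continuous_on {0<..} (\<lambda>x. of_real x powr (s - 1) :: complex)"
    by (intro continuous_on_powr_complex continuous_intros) (auto simp: complex_nonpos_Reals_iff)
  ultimately have "continuous_on {0<..} (L_integrand n s)"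
    unfolding L_integrand_def Hstar_of_real
    by (intro continuous_on_divide continuous_on_of_real continuous_on_prod continuous_on_add
          continuous_on_power continuous_on_id continuous_on_const ballI)
       (simp_all only: of_real_eq_0_iff not_False_eq_True)
  hence "set_borel_measurable borel {0<..} (L_integrand n s)"
    by (intro set_measurable_continuous_on) auto
  thus ?thesis
    by (simp add: set_borel_measurable_def)
qed

text \<open>The two edges of the strip are exactly the conditions that the comparison exponent
  exceeds -1 at 0 and is below -1 at infinity.\<close>

lemma L_integrand_integrable:
  assumes "0 < Re s" "Re s < 2 * real n"
  shows "set_integrable lborel {0<..} (L_integrand n s)"
proof (rule set_integrable_powr_bounds[OF L_integrand_measurable,
      where a = "Re s - 1" and b = "Re s - 1 - 2 * real n"])
  fix x :: real
  assume "0 < x"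
  thus "norm (L_integrand n s x) \<le> x powr (Re s - 1)"
    using divide_left_mono[OF prod_sum_squares_ge(1)[where n = n and x = x], of "x powr (Re s - 1)"]
      prod_sum_squares_ge(1)[where n = n and x = x]
    by (simp add: norm_L_integrand)
next
  fix x :: real
  assume x: "1 \<le> x"
  have "x powr (Re s - 1) / (\<Prod>k=1..n. x\<^sup>2 + (real k)\<^sup>2) \<le> x powr (Re s - 1) / x ^ (2 * n)"
    using prod_sum_squares_ge[where n = n and x = x] x
    by (intro divide_left_mono mult_pos_pos) (linarith | simp)+
  also have "x ^ (2 * n) = x powr (2 * real n)"
    using powr_realpow[of x "2 * n"] x by simp
  finally show "norm (L_integrand n s x) \<le> x powr (Re s - 1 - 2 * real n)"
    using x by (simp add: norm_L_integrand powr_diff)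
qed (use assms in auto)

lemma L_eq_set_integral: "L n s = (LINT x:{0<..}|lborel. L_integrand n s x)"
  unfolding L_def zero_ereal_def by (rule interval_integral_to_infinity_eq)

section \<open>Holomorphy of \<open>L\<close> on the strip\<close>

lemma L_integrand_add:
  "x > 0 \<Longrightarrow> L_integrand n (s + h) x = L_integrand n s x * exp (h * of_real (ln x))"
  by (simp add: L_integrand_def powr_def Ln_of_real algebra_simps exp_add exp_diff)

text \<open>A bound independent of \<open>h\<close>, for use in dominated convergence. With u = ln
  x, combine |e^w - 1| \<le> |w| e^|w| for w = hu with |u| \<le> e^(\<delta>|u|) / \<delta>, which
  absorbs the logarithm at the cost of doubling the exponent.\<close>

lemma norm_exp_diff_quotient_le:
  fixes h :: complex and x \<delta> :: real
  assumes h: "h \<noteq> 0" "norm h \<le> \<delta>" and x: "x > 0"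
  shows "norm ((exp (h * of_real (ln x)) - 1) / h) \<le> (x powr (2 * \<delta>) + x powr (- (2 * \<delta>))) / \<delta>"
proof -
  define u where "u = ln x"
  have \<delta>: "\<delta> > 0"
    using h by (smt (verit) zero_less_norm_iff)
  have "norm (exp (h * of_real u) - 1) \<le> exp (norm (h * of_real u)) * norm (h * of_real u)"
    using Taylor_exp_field[of "h * of_real u" 0] by simp
  hence "norm ((exp (h * of_real u) - 1) / h) \<le> exp (norm h * \<bar>u\<bar>) * \<bar>u\<bar>"
    using h by (simp add: norm_divide norm_mult field_simps)
  also have "\<dots> \<le> exp (\<delta> * \<bar>u\<bar>) * (exp (\<delta> * \<bar>u\<bar>) / \<delta>)"
  proof (rule mult_mono)
    have "\<delta> * \<bar>u\<bar> \<le> exp (\<delta> * \<bar>u\<bar>)"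
      using exp_ge_add_one_self[of "\<delta> * \<bar>u\<bar>"] by linarith
    thus "\<bar>u\<bar> \<le> exp (\<delta> * \<bar>u\<bar>) / \<delta>"
      using \<delta> by (simp add: field_simps)
  qed (use h \<delta> in \<open>auto intro: mult_right_mono\<close>)
  also have "\<dots> = exp (2 * \<delta> * \<bar>u\<bar>) / \<delta>"
    by (simp flip: exp_add)
  also have "exp (2 * \<delta> * \<bar>u\<bar>) \<le> exp (2 * \<delta> * u) + exp (- (2 * \<delta> * u))"
    by (cases "u \<ge> 0") auto
  also have "\<dots> = x powr (2 * \<delta>) + x powr (- (2 * \<delta>))"
    using x by (simp add: powr_def u_def)
  finally show ?thesis
    using \<delta> by (simp add: u_def divide_right_mono)
qed

text \<open>Differentiation under the integral sign. Dominated convergence is a statement about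
  sequences, so the limit is tested along arbitrary null sequences \<open>X\<close>.\<close>

lemma L_has_field_derivative:
  assumes s: "0 < Re s" "Re s < 2 * real n"
  shows "(L n has_field_derivative (LINT x:{0<..}|lborel. L_integrand n s x * of_real (ln x))) (at s)"
  unfolding DERIV_def tendsto_at_iff_sequentially
proof (intro allI impI)
  fix X :: "nat \<Rightarrow> complex"
  assume X: "\<forall>i. X i \<in> UNIV - {0}" "X \<longlonglongrightarrow> 0"
  \<comment> \<open>with this choice \<open>s +- 2 * \<delta>\<close> stay in the strip, which makes the dominating function integrable\<close>
  define \<delta> where "\<delta> = min (Re s) (2 * real n - Re s) / 3"
  have \<delta>: "\<delta> > 0" "2 * \<delta> < Re s" "2 * \<delta> < 2 * real n - Re s"
    using s by (auto simp: \<delta>_def min_def)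
  have "eventually (\<lambda>i. norm (X i) < \<delta>) sequentially"
    using X(2) \<delta>(1) by (auto simp: tendsto_iff)
  then obtain N where N: "\<And>i. i \<ge> N \<Longrightarrow> norm (X i) < \<delta>"
    by (auto simp: eventually_sequentially)
  \<comment> \<open>Dropping the first \<open>N\<close> terms makes the bound by \<delta> hold for
    every index; \<open>LIMSEQ_offset\<close> undoes this at the end.\<close>
  define h where "h = (\<lambda>i. X (i + N))"
  have h: "h i \<noteq> 0" "norm (h i) < \<delta>" for i
    using X(1) N by (auto simp: h_def)
  have h_lim: "h \<longlonglongrightarrow> 0"
    unfolding h_def using X(2) by (rule LIMSEQ_ignore_initial_segment)
  define q where "q = (\<lambda>i x. (L_integrand n (s + h i) x - L_integrand n s x) / h i)"
  define D where "D = (\<lambda>x. L_integrand n s x * of_real (ln x))"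
  \<comment> \<open>Multiplying the norm of the integrand by x^c amounts to shifting
    \<open>s\<close> by the real number c. So the uniform bound on the difference quotient becomes a
    sum of two shifted integrands.\<close>
  define w where "w = (\<lambda>x. (norm (L_integrand n (s + of_real (2 * \<delta>)) x)
                          + norm (L_integrand n (s - of_real (2 * \<delta>)) x)) / \<delta>)"
  have shift: "set_integrable lborel {0<..} (L_integrand n (s + z))" if "norm z \<le> 2 * \<delta>" for z
    using abs_Re_le_cmod[of z] that \<delta> by (intro L_integrand_integrable) auto
  have sh: "set_integrable lborel {0<..} (L_integrand n (s + h i))" for i
    using h(2)[of i] \<delta>(1) by (intro shift) auto
  have s0: "set_integrable lborel {0<..} (L_integrand n s)"
    using L_integrand_integrable[OF s] .
  have q_int: "set_integrable lborel {0<..} (q i)" for i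
    unfolding q_def by (intro set_integrable_divide set_integral_diff sh s0)
  have quotient: "(L n (s + h i) - L n s) / h i = (LINT x:{0<..}|lborel. q i x)" for i
    unfolding q_def L_eq_set_integral
    by (simp add: set_integral_diff(2)[OF sh s0])
  have q_eq: "q i x = L_integrand n s x * ((exp (h i * of_real (ln x)) - 1) / h i)" if "x > 0" for i x
    unfolding q_def L_integrand_add[OF that] by (simp add: algebra_simps diff_divide_distrib)
  have q_lim: "(\<lambda>i. q i x) \<longlonglongrightarrow> D x" if "x > 0" for x
  proof -
    have "((\<lambda>z. exp (z * of_real (ln x))) has_field_derivative of_real (ln x)) (at 0)"
      by (auto intro!: derivative_eq_intros)
    hence "((\<lambda>z. (exp (z * of_real (ln x)) - 1) / z) \<longlongrightarrow> of_real (ln x :: real)) (at (0::complex))"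
      by (simp add: DERIV_def)
    hence "(\<lambda>i. (exp (h i * of_real (ln x)) - 1) / h i) \<longlonglongrightarrow> of_real (ln x)"
      by (rule filterlim_compose) (use h h_lim in \<open>auto simp: filterlim_at\<close>)
    thus ?thesis
      unfolding D_def q_eq[OF that] by (intro tendsto_intros)
  qed
  have q_bound: "norm (q i x) \<le> w x" if "x > 0" for i x
  proof -
    have "norm (q i x) \<le> norm (L_integrand n s x) * ((x powr (2 * \<delta>) + x powr (- (2 * \<delta>))) / \<delta>)"
      unfolding q_eq[OF that] norm_mult
      by (intro mult_left_mono norm_exp_diff_quotient_le) (use h[of i] that in auto)
    also have "\<dots> = w x"
    proof -
      have "norm (L_integrand n (s + of_real c) x) = norm (L_integrand n s x) * x powr c" for c
      proof -
        have "x powr (Re s + c - 1) = x powr (Re s - 1) * x powr c"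
          unfolding powr_add[symmetric] by (simp add: algebra_simps)
        thus ?thesis
          using that by (simp add: norm_L_integrand)
      qed
      from this[of "2 * \<delta>"] this[of "- (2 * \<delta>)"] show ?thesis
        by (simp add: w_def distrib_left)
    qed
    finally show ?thesis .
  qed
  have w_int: "set_integrable lborel {0<..} w"
  proof -
    have "set_integrable lborel {0<..} (\<lambda>x. norm (L_integrand n (s + z) x))" if "norm z \<le> 2 * \<delta>" for z
      using integrable_norm[OF shift[OF that, unfolded set_integrable_def]]
      by (simp add: set_integrable_def)
    from this[of "of_real (2 * \<delta>)"] this[of "- of_real (2 * \<delta>)"] show ?thesis
      unfolding w_def using \<delta>(1) by (auto intro!: set_integrable_divide set_integral_add)
  qed
  have "(\<lambda>i. LINT x:{0<..}|lborel. q i x) \<longlonglongrightarrow> (LINT x:{0<..}|lborel. D x)"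
    unfolding set_lebesgue_integral_def
  proof (rule integral_dominated_convergence)
    show "(\<lambda>x. indicator {0<..} x *\<^sub>R q i x) \<in> borel_measurable lborel" for i
      using q_int[of i] by (auto simp: set_integrable_def)
    show "(\<lambda>x. indicator {0<..} x *\<^sub>R D x) \<in> borel_measurable lborel"
    proof (rule borel_measurable_LIMSEQ_metric)
      show "(\<lambda>x. indicator {0<..} x *\<^sub>R q i x) \<in> borel_measurable lborel" for i
        using q_int[of i] by (auto simp: set_integrable_def)
      show "(\<lambda>i. indicator {0<..} x *\<^sub>R q i x) \<longlonglongrightarrow> indicator {0<..} x *\<^sub>R D x" for x
        by (cases "x > 0") (auto intro: q_lim)
    qed
    show "integrable lborel (\<lambda>x. indicator {0<..} x *\<^sub>R w x)"
      using w_int by (simp add: set_integrable_def)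
    show "AE x in lborel. (\<lambda>i. indicator {0<..} x *\<^sub>R q i x) \<longlonglongrightarrow> indicator {0<..} x *\<^sub>R D x"
      by (intro AE_I2) (auto simp: indicator_def intro: q_lim)
    show "AE x in lborel. norm (indicator {0<..} x *\<^sub>R q i x) \<le> indicator {0<..} x *\<^sub>R w x" for i
      by (intro AE_I2) (auto simp: indicator_def intro: q_bound)
  qed
  hence "(\<lambda>i. (L n (s + X (i + N)) - L n s) / X (i + N)) \<longlonglongrightarrow> (LINT x:{0<..}|lborel. D x)"
    by (simp only: flip: quotient) (simp add: h_def)
  thus "((\<lambda>h. (L n (s + h) - L n s) / h) \<circ> X) \<longlonglongrightarrow>
          (LINT x:{0<..}|lborel. L_integrand n s x * of_real (ln x))"
    unfolding D_def comp_def by (rule LIMSEQ_offset)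
qed

section \<open>The formula on a real interval and its continuation to the strip\<close>

text \<open>The range stops at 2, whatever \<open>n\<close> is, because the partial fractions are
  integrated one by one and each decays only like x^(-2).\<close>

lemma L_of_real:
  fixes \<sigma> :: real
  assumes "n \<ge> 1" "0 < \<sigma>" "\<sigma> < 2"
  shows "L n (of_real \<sigma>) = of_real pi / (sin (of_real \<sigma> * of_real pi / 2) * fact (2 * n))
                            * zetaHstar n (- of_real \<sigma>)"
proof -
  define c where "c = (\<lambda>k. (-1) ^ (k - 1) * real ((2 * n) choose (n + k)) * 2 * (real k)\<^sup>2 / fact (2 * n))"
  define S where "S = sin (pi * \<sigma> / 2)"
  define r where "r = (\<lambda>k x. x powr (\<sigma> - 1) / (x\<^sup>2 + (real k)\<^sup>2))"
  have integrand: "L_integrand n (of_real \<sigma>) x = of_real (\<Sum>k=1..n. c k * r k x)" if "x > 0" for x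
  proof -
    have "L_integrand n (of_real \<sigma>) x = of_real (x powr (\<sigma> - 1) * (1 / (\<Prod>k=1..n. x\<^sup>2 + (real k)\<^sup>2)))"
      using that unfolding L_integrand_def Hstar_of_real by (simp add: powr_of_real[symmetric])
    also have "x powr (\<sigma> - 1) * (1 / (\<Prod>k=1..n. x\<^sup>2 + (real k)\<^sup>2)) = (\<Sum>k=1..n. c k * r k x)"
      unfolding inverse_prod_squares_partial_fractions[OF assms(1)] sum_distrib_left
      by (intro sum.cong refl) (simp add: c_def r_def mult_ac)
    finally show ?thesis .
  qed
  have "L n (of_real \<sigma>) = (LINT x:{0<..}|lborel. of_real (\<Sum>k=1..n. c k * r k x))"
    unfolding L_eq_set_integral by (intro set_lebesgue_integral_cong) (auto simp: integrand)
  also have "\<dots> = of_real (LINT x:{0<..}|lborel. \<Sum>k=1..n. c k * r k x)"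
    by (rule set_integral_complex_of_real)
  also have "(LINT x:{0<..}|lborel. \<Sum>k=1..n. c k * r k x)
      = (\<Sum>k=1..n. LINT x:{0<..}|lborel. c k * r k x)"
    unfolding set_lebesgue_integral_def scaleR_sum_right
  proof (rule Bochner_Integration.integral_sum)
    fix k assume "k \<in> {1..n}"
    hence "set_integrable lborel {0<..} (r k)"
      unfolding r_def by (intro set_integrable_powr_div_sum_squares assms) auto
    thus "integrable lborel (\<lambda>x. indicator {0<..} x *\<^sub>R (c k * r k x))"
      using set_integrable_mult_right[of "c k" lborel "{0<..}" "r k"]
      by (simp add: set_integrable_def)
  qed
  also have "\<dots> = (\<Sum>k=1..n. c k * (real k powr (\<sigma> - 2) * pi / (2 * S)))"
  proof (intro sum.cong refl)
    fix k assume "k \<in> {1..n}"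
    thus "(LINT x:{0<..}|lborel. c k * r k x) = c k * (real k powr (\<sigma> - 2) * pi / (2 * S))"
      using integral_powr_div_sum_squares[of \<sigma> "real k"] assms by (simp add: r_def S_def del: times_divide_eq_right)
  qed
  \<comment> \<open>The factor 2 k^2 in \<open>c k\<close> cancels the 2 beside \<open>S\<close> and
    raises k^(\<sigma>-2) to k^\<sigma>, the power occurring in \<open>zetaHstar\<close> at
    -\<sigma>.\<close>
  also have "\<dots> = (\<Sum>k=1..n. pi / (S * fact (2 * n))
                     * ((-1) ^ (k - 1) * real ((2 * n) choose (n + k)) * real k powr \<sigma>))"
  proof (intro sum.cong refl)
    fix k assume "k \<in> {1..n}"
    hence "real k powr (\<sigma> - 2) * (real k)\<^sup>2 = real k powr \<sigma>"
      by (simp add: powr_diff)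
    thus "c k * (real k powr (\<sigma> - 2) * pi / (2 * S)) = pi / (S * fact (2 * n))
            * ((-1) ^ (k - 1) * real ((2 * n) choose (n + k)) * real k powr \<sigma>)"
      by (simp add: c_def mult_ac)
  qed
  also have "\<dots> = pi / (S * fact (2 * n))
                     * (\<Sum>k=1..n. (-1) ^ (k - 1) * real ((2 * n) choose (n + k)) * real k powr \<sigma>)"
    by (simp only: sum_distrib_left)
  also have "complex_of_real (\<dots>) = of_real pi / (of_real S * fact (2 * n)) * zetaHstar n (- of_real \<sigma>)"
    by (simp add: zetaHstar_def powr_of_real[symmetric])
  finally show ?thesis
    by (simp add: S_def mult.commute flip: sin_of_real)
qed

lemma zetaHstar_holomorphic [holomorphic_intros]:
  "f holomorphic_on A \<Longrightarrow> (\<lambda>s. zetaHstar n (f s)) holomorphic_on A"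
  unfolding zetaHstar_def by (intro holomorphic_intros)

text \<open>With the sine multiplied out, both sides are holomorphic on the whole strip, so the
  identity theorem also reaches the even integers inside it.\<close>

lemma sin_times_L:
  assumes "n \<ge> 1" "0 < Re s" "Re s < 2 * real n"
  shows "sin (s * of_real pi / 2) * fact (2 * n) * L n s = of_real pi * zetaHstar n (- s)"
proof -
  define S where "S = {s. 0 < Re s} \<inter> {s. Re s < 2 * real n}"
  define G where "G = (\<lambda>s. sin (s * of_real pi / 2) * fact (2 * n) * L n s - of_real pi * zetaHstar n (- s))"
  have less_2n: "x < 2 * real n" if "x < 2" for x
  proof -
    have "real n \<ge> 1"
      using assms(1) by simp
    thus ?thesis
      using that by linarith
  qed
  have "G s = 0"
  \<comment> \<open>The zeros of \<open>G\<close> on the real interval (0,2) accumulate at 1, which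
    lies in the strip for every n \<ge> 1.\<close>
  proof (rule analytic_continuation[where f = G and S = S and U = "of_real ` {0<..<2}" and \<xi> = 1])
    have "L n holomorphic_on S"
      using L_has_field_derivative unfolding holomorphic_on_def field_differentiable_def S_def
      by (blast intro: has_field_derivative_at_within)
    thus "G holomorphic_on S"
      unfolding G_def by (intro holomorphic_intros) auto
    show "open S"
      unfolding S_def by (intro open_Int open_halfspace_Re_gt open_halfspace_Re_lt)
    show "connected S"
      unfolding S_def by (intro convex_connected convex_Int convex_halfspace_Re_gt convex_halfspace_Re_lt)
    show "of_real ` {0<..<2} \<subseteq> S" "1 \<in> S" "s \<in> S"
      using assms(2,3) by (auto simp: S_def intro: less_2n)
    show "G z = 0" if z: "z \<in> of_real ` {0<..<2}" for z
    proof -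
      obtain \<sigma> where \<sigma>: "z = of_real \<sigma>" "0 < \<sigma>" "\<sigma> < 2"
        using z by auto
      have "pi * \<sigma> < pi * 2"
        using \<sigma> by simp
      hence "sin (\<sigma> * pi / 2) > 0"
        using \<sigma> by (intro sin_gt_zero) (auto simp: mult.commute)
      hence "complex_of_real (sin (\<sigma> * pi / 2)) \<noteq> 0"
        by (simp del: sin_of_real)
      hence "sin (z * of_real pi / 2) \<noteq> 0"
        by (simp add: \<sigma>(1) flip: sin_of_real)
      thus ?thesis
        using L_of_real[OF assms(1) \<sigma>(2,3)] by (simp add: G_def \<sigma>(1) field_simps)
    qed
    show "1 islimpt complex_of_real ` {0<..<2}"
      unfolding islimpt_approachable
    proof (intro allI impI)
      fix e :: real assume "e > 0"
      \<comment> \<open>The term \<open>e / 2\<close> keeps the point within distance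
        \<open>e\<close> of 1, and the cap \<open>1 / 2\<close> keeps it below 2.\<close>
      hence "complex_of_real (1 + min (e / 2) (1 / 2)) \<in> of_real ` {0<..<2}"
        by (intro imageI) (auto simp: min_def)
      moreover have "dist (complex_of_real (1 + min (e / 2) (1 / 2))) 1 < e"
        using \<open>e > 0\<close> by (auto simp: dist_norm min_def)
      moreover have "complex_of_real (1 + min (e / 2) (1 / 2)) \<noteq> 1"
        using \<open>e > 0\<close> by (auto simp: min_def)
      ultimately show "\<exists>x'\<in>complex_of_real ` {0<..<2}. x' \<noteq> 1 \<and> dist x' 1 < e"
        by blast
    qed
  qed
  thus ?thesis
    by (simp add: G_def)
qed

section \<open>Even integers, removable singularities and trivial zeros\<close>

lemma even_integers_iff: "s \<in> even_integers \<longleftrightarrow> sin (s * of_real pi / 2) = 0"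
proof -
  have "s = of_int (2 * k) \<longleftrightarrow> s * of_real pi / 2 = of_real (of_int k * pi)" for k
    by (simp add: field_simps)
  thus ?thesis
    by (simp add: even_integers_def sin_eq_0 image_iff)
qed

text \<open>Every set of integers is closed. Taking \<open>s\<close> out of the set first lets the
  argument cover even \<open>s\<close> too.\<close>

lemma eventually_not_even_integer: "eventually (\<lambda>w. w \<notin> even_integers) (at s)"
proof -
  have "closed (even_integers - {s})"
    by (rule closed_subset_Ints) (auto simp: even_integers_def)
  hence "eventually (\<lambda>w. w \<in> - (even_integers - {s}) - {s}) (at s)"
    by (intro eventually_at_in_open open_Compl) auto
  thus ?thesis
    by eventually_elim auto
qed

lemma L_eq_L_formula:
  assumes "n \<ge> 1" "0 < Re s" "Re s < 2 * real n" "s \<notin> even_integers"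
  shows "L n s = L_formula n s"
  using sin_times_L[OF assms(1-3)] assms(4)
  by (simp add: L_formula_def even_integers_iff field_simps)

text \<open>\<open>L n\<close> is continuous at \<open>s\<close> and agrees with the formula on a
  punctured neighbourhood. At an even \<open>s\<close> in the strip this shows that the singularity
  of the formula is removable.\<close>

lemma L_formula_tendsto_L:
  assumes "n \<ge> 1" "0 < Re s" "Re s < 2 * real n"
  shows "(L_formula n \<longlongrightarrow> L n s) (at s)"
proof (rule Lim_transform_eventually)
  show "(L n \<longlongrightarrow> L n s) (at s)"
    using DERIV_isCont[OF L_has_field_derivative[OF assms(2,3)]] by (rule isContD)
  have "open ({s. 0 < Re s} \<inter> {s. Re s < 2 * real n})"
    by (intro open_Int open_halfspace_Re_gt open_halfspace_Re_lt)
  hence "eventually (\<lambda>w. w \<in> {s. 0 < Re s} \<inter> {s. Re s < 2 * real n} - {s}) (at s)"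
    by (rule eventually_at_in_open) (use assms in auto)
  with eventually_not_even_integer[of s] show "eventually (\<lambda>w. L n w = L_formula n w) (at s)"
    by eventually_elim (use assms L_eq_L_formula in auto)
qed

text \<open>At \<open>s = 2 * m\<close> the sine in \<open>sin_times_L\<close> vanishes;
  \<open>m \<le> n - 1\<close> keeps this point inside the strip.\<close>

lemma zetaHstar_trivial_zeros:
  assumes "m \<in> {1..n - 1}"
  shows "zetaHstar n (- (2 * of_nat m)) = 0"
proof -
  have "(2 * of_nat m :: complex) \<in> even_integers"
    unfolding even_integers_def by (rule image_eqI[of _ _ "int m"]) auto
  moreover have "real m < real n"
    using assms by auto
  ultimately show ?thesis
    using sin_times_L[of n "2 * of_nat m"] assms by (simp add: even_integers_iff)
qed

lemma L_formula_meromorphic: "L_formula n meromorphic_on UNIV"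
proof -
  have "(\<lambda>s. zetaHstar n (- s)) analytic_on UNIV"
    by (simp add: analytic_on_open) (intro holomorphic_intros)
  hence "(\<lambda>s. zetaHstar n (- s)) meromorphic_on UNIV"
    by (rule analytic_on_imp_meromorphic_on)
  moreover have "(\<lambda>s. sin (s * of_real pi / 2)) analytic_on (UNIV :: complex set)"
    by (intro analytic_intros) auto
  hence "(\<lambda>s. sin (s * of_real pi / 2)) meromorphic_on (UNIV :: complex set)"
    by (rule analytic_on_imp_meromorphic_on)
  ultimately show ?thesis
    unfolding L_formula_def by (intro meromorphic_intros)
qed

lemma L_formula_analytic_at:
  assumes "s \<notin> even_integers"
  shows "L_formula n analytic_on {s}"
proof -
  have "(\<lambda>s. zetaHstar n (- s)) analytic_on UNIV"
    by (simp add: analytic_on_open) (intro holomorphic_intros)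
  hence "(\<lambda>s. zetaHstar n (- s)) analytic_on {s}"
    by (rule analytic_on_subset) auto
  thus ?thesis
    unfolding L_formula_def using assms
    by (intro analytic_intros) (auto simp: even_integers_iff)
qed

section \<open>The special case n = 1, s = 1\<close>

lemma integral_inverse_x2_plus_1: "(LBINT x=0..\<infinity>. 1 / (x\<^sup>2 + 1)) = pi / 2"
proof -
  have "(LBINT x=0..\<infinity>. 1 / (x\<^sup>2 + 1)) = (LINT x:{0<..}|lborel. 1 / (x\<^sup>2 + 1))"
    unfolding zero_ereal_def by (rule interval_integral_to_infinity_eq)
  also have "\<dots> = (LINT x:{0<..}|lborel. x powr (1 - 1) / (x\<^sup>2 + 1\<^sup>2))"
    by (intro set_lebesgue_integral_cong) auto
  also have "\<dots> = pi / 2"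
    by (subst integral_powr_div_sum_squares) auto
  finally show ?thesis .
qed

lemma L_1_1: "L 1 1 = of_real (LBINT x=0..\<infinity>. 1 / (x\<^sup>2 + 1))"
proof -
  have "L 1 1 = (LINT x:{0<..}|lborel. complex_of_real (1 / (x\<^sup>2 + 1)))"
    unfolding L_eq_set_integral
    by (intro set_lebesgue_integral_cong) (auto simp: L_integrand_def Hstar_altdef)
  also have "\<dots> = of_real (LINT x:{0<..}|lborel. 1 / (x\<^sup>2 + 1))"
    by (rule set_integral_complex_of_real)
  finally show ?thesis
    unfolding zero_ereal_def by (simp only: interval_integral_to_infinity_eq)
qed

section \<open>Meromorphic continuation of \<open>L\<close> and the combined statement\<close>

theorem theorem1:
  fixes n :: nat
  assumes "n \<ge> 1"
  shows
    "zetaHstar n holomorphic_on UNIV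
     \<and> (\<forall>m\<in>{1..n-1}. zetaHstar n (- (2 * of_nat m)) = 0)
     \<and> (\<forall>s. 0 < Re s \<and> Re s < 2 * real n \<longrightarrow>
           interval_lebesgue_integrable lborel 0 \<infinity> (L_integrand n s)
           \<and> (s \<notin> even_integers \<longrightarrow> L n s = L_formula n s)
           \<and> (L_formula n \<longlongrightarrow> L n s) (at s))
     \<and> (\<exists>F. F meromorphic_on UNIV
           \<and> (\<forall>s. 0 < Re s \<and> Re s < 2 * real n \<longrightarrow> F s = L n s)
           \<and> (\<forall>s. s \<notin> even_integers \<longrightarrow> F s = L_formula n s)
           \<and> F analytic_on (- even_integers \<union> (\<lambda>m. 2 * of_nat m) ` {1..n-1})
           \<and> (\<forall>s. is_pole F s \<longrightarrow> s \<in> even_integers)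
           \<and> (\<forall>m\<in>{1..n-1}. \<not> is_pole F (2 * of_nat m)))
     \<and> L 1 1 = of_real (LBINT x=0..\<infinity>. 1 / (x\<^sup>2 + 1))
     \<and> (LBINT x=0..\<infinity>. 1 / (x\<^sup>2 + 1)) = pi / 2"
proof (intro conjI)
  show "zetaHstar n holomorphic_on UNIV"
    using zetaHstar_holomorphic[of "\<lambda>s. s" UNIV n] by simp
  show "\<forall>m\<in>{1..n-1}. zetaHstar n (- (2 * of_nat m)) = 0"
    using zetaHstar_trivial_zeros by blast
  show "\<forall>s. 0 < Re s \<and> Re s < 2 * real n \<longrightarrow>
           interval_lebesgue_integrable lborel 0 \<infinity> (L_integrand n s)
           \<and> (s \<notin> even_integers \<longrightarrow> L n s = L_formula n s)
           \<and> (L_formula n \<longlongrightarrow> L n s) (at s)"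
    unfolding zero_ereal_def interval_integrable_to_infinity_eq
    using L_integrand_integrable L_eq_L_formula[OF assms] L_formula_tendsto_L[OF assms] by blast
  \<comment> \<open>\<open>L_formula\<close> has the conventional value \<open>0\<close> at even
    integers. \<open>remove_sings\<close> replaces it by the limit wherever one exists, so
    \<open>F\<close> agrees with \<open>L n\<close> on the whole strip and with the formula off the
    even integers.\<close>
  define F where "F = remove_sings (L_formula n)"
  have F_nonEven: "F analytic_on {s}" if "s \<notin> even_integers" for s
    unfolding F_def by (intro remove_sings_analytic_on L_formula_analytic_at that)
  \<comment> \<open>A finite limit at an isolated singularity makes it removable; here the limit is
    the value of the convergent integral.\<close>
  have F_even: "F analytic_on {2 * of_nat m}" if m: "m \<in> {1..n-1}" for m
  proof -
    have "real m < real n"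
      using m by auto
    hence "(L_formula n \<longlongrightarrow> L n (2 * of_nat m)) (at (2 * of_nat m))"
      using m by (intro L_formula_tendsto_L assms) auto
    moreover have "isolated_singularity_at (L_formula n) (2 * of_nat m)"
      by (intro meromorphic_on_isolated_singularity meromorphic_on_subset[OF L_formula_meromorphic]) auto
    ultimately show ?thesis
      unfolding F_def by (intro remove_sings_analytic_at)
  qed
  show "\<exists>F. F meromorphic_on UNIV
           \<and> (\<forall>s. 0 < Re s \<and> Re s < 2 * real n \<longrightarrow> F s = L n s)
           \<and> (\<forall>s. s \<notin> even_integers \<longrightarrow> F s = L_formula n s)
           \<and> F analytic_on (- even_integers \<union> (\<lambda>m. 2 * of_nat m) ` {1..n-1})
           \<and> (\<forall>s. is_pole F s \<longrightarrow> s \<in> even_integers)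
           \<and> (\<forall>m\<in>{1..n-1}. \<not> is_pole F (2 * of_nat m))"
  proof (intro exI[of _ F] conjI)
    show "F meromorphic_on UNIV"
      unfolding F_def by (intro remove_sings_meromorphic L_formula_meromorphic)
    show "\<forall>s. 0 < Re s \<and> Re s < 2 * real n \<longrightarrow> F s = L n s"
      unfolding F_def using L_formula_tendsto_L[OF assms] by blast
    show "\<forall>s. s \<notin> even_integers \<longrightarrow> F s = L_formula n s"
      unfolding F_def using L_formula_analytic_at by auto
    show "F analytic_on (- even_integers \<union> (\<lambda>m. 2 * of_nat m) ` {1..n-1})"
      using F_nonEven F_even by (subst analytic_on_analytic_at) auto
    show "\<forall>s. is_pole F s \<longrightarrow> s \<in> even_integers"
      using F_nonEven analytic_at_imp_no_pole by blast
    show "\<forall>m\<in>{1..n-1}. \<not> is_pole F (2 * of_nat m)"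
      using F_even analytic_at_imp_no_pole by blast
  qed
qed (rule L_1_1 integral_inverse_x2_plus_1)+

end
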